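(* Let $N\in\mathbb{N}$ and let $\{X_i : i=1,\dots,N\}$ be a family of half-open intervals of $[0,1]$. Let $\{x_0:=0<x_1<\cdots<x_N:=1\}$ be a partition of $[0,1]$ and let $\{u_i : i=1,\dots,N\}$ be a family of affine mappings from $X_i$ onto $[x_{i-1},x_i)$ for $i=1,\dots,N-1$, and from $X_N^+:=X_N\cup u_N^{-1}(1-)$ onto $[x_{N-1},x_N]$, where $u_N$ maps $X_N$ onto $[x_{N-1},x_N)$. Let $p\in(0,\infty]$, let $\lambda_i\in L^p(X_i,[0,1])$ and $S_i\in L^\infty(X_i,\mathbb{R})$, $i=1,\dots,N$. Then the operator $\Phi:L^p[0,1]\to\mathbb{R}^{[0,1]}$ defined by $$\Phi g:=\sum_{i=1}^N(\lambda_i\circ u_i^{-1})\,\chi_{u_i(X_i)}+\sum_{i=1}^N(S_i\circ u_i^{-1})\cdot(g_i\circ u_i^{-1})\,\chi_{u_i(X_i)},\qquad g_i:=g|_{X_i},$$ maps $L^p[0,1]$ into itself. Moreover, if $$\begin{cases}\displaystyle\sum_{i=1}^N a_i\|S_i\|_{\infty,X_i}^p<1, & p\in(0,1),\\[2mm] \displaystyle\Bigl(\sum_{i=1}^N a_i\|S_i\|_{\infty,X_i}^p\Bigr)^{1/p}<1, & p\in[1,\infty),\\[2mm] \max\{\|S_i\|_{\infty,X_i} : i=1,\dots,N\}<1, & p=\infty,\end{cases}$$ where $a_i$ denotes the Lipschitz constant of $u_i$, then $\Phi$ is contractive on $L^p[0,1]$ and its unique fixed point $\mathfrak{f}$ is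 an element of $L^p[0,1]$.
   Context: $L^p[0,1]$ denotes the Lebesgue space of real-valued functions on $[0,1]$, with its usual norm $\|\cdot\|_{L^p}$ for $1\le p\le\infty$, and with the complete metric $d_p(f,g)=\int_{[0,1]}|f-g|^p\,dx$ for $0<p<1$. $L^p(X_i,[0,1])$ denotes the $L^p$ functions on $X_i$ with values in $[0,1]$. $\|\cdot\|_{\infty,X_i}$ is the $L^\infty$ norm on $X_i$; $\chi_M$ is the characteristic function of $M$. $u_N^{-1}(1-)$ is the endpoint of $X_N$ that the (affinely extended) map $u_N$ sends to $1$. "Contractive" means Lipschitz with a constant $c\in[0,1)$ with respect to the norm ($p\ge1$) or the metric $d_p$ ($p<1$). *)

theory Defs
  imports "HOL-Analysis.Analysis" "HOL-Probability.Essential_Supremum"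
begin

text \<open>
  Elements of the Lebesgue spaces are represented by Lebesgue measurable functions; two of them
  denote the same element iff they agree almost everywhere, so equality in $L^p$ is
  \<^term>\<open>eq_ae\<close> below. The values of a representative outside \<open>X\<close> are irrelevant.
  The exponent ranges over \<^typ>\<open>ennreal\<close>, with \<open>p = \<infinity>\<close> included.
\<close>

definition eq_ae :: "real set \<Rightarrow> (real \<Rightarrow> real) \<Rightarrow> (real \<Rightarrow> real) \<Rightarrow> bool" where
  "eq_ae X f g \<longleftrightarrow> (AE t in lebesgue_on X. f t = g t)"

definition Lp_space :: "ennreal \<Rightarrow> real set \<Rightarrow> (real \<Rightarrow> real) set" where
  "Lp_space p X = {f \<in> borel_measurable (lebesgue_on X).
     if p = \<infinity> then esssup (lebesgue_on X) (\<lambda>t. ennreal \<bar>f t\<bar>) < \<infinity>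
     else integrable (lebesgue_on X) (\<lambda>t. \<bar>f t\<bar> powr enn2real p)}"

definition Lp_space_into :: "ennreal \<Rightarrow> real set \<Rightarrow> real set \<Rightarrow> (real \<Rightarrow> real) set" where
  "Lp_space_into p X V = {f \<in> Lp_space p X. AE t in lebesgue_on X. f t \<in> V}"

definition Linf_norm :: "real set \<Rightarrow> (real \<Rightarrow> real) \<Rightarrow> real" where
  "Linf_norm X f = enn2real (esssup (lebesgue_on X) (\<lambda>t. ennreal \<bar>f t\<bar>))"

text \<open>The usual norm, meant for \<open>1 \<le> p \<le> \<infinity>\<close>.\<close>

definition Lp_norm :: "ennreal \<Rightarrow> real set \<Rightarrow> (real \<Rightarrow> real) \<Rightarrow> real" where
  "Lp_norm p X f =
     (if p = \<infinity> then Linf_norm X f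
      else (\<integral>t. \<bar>f t\<bar> powr enn2real p \<partial>lebesgue_on X) powr (1 / enn2real p))"

text \<open>For \<open>p < 1\<close> this is the complete metric $d_p$ (no root is taken).\<close>

definition Lp_dist :: "ennreal \<Rightarrow> real set \<Rightarrow> (real \<Rightarrow> real) \<Rightarrow> (real \<Rightarrow> real) \<Rightarrow> real" where
  "Lp_dist p X f g =
     (if p < 1 then (\<integral>t. \<bar>f t - g t\<bar> powr enn2real p \<partial>lebesgue_on X)
      else Lp_norm p X (\<lambda>t. f t - g t))"

definition contractive_on_Lp ::
  "ennreal \<Rightarrow> real set \<Rightarrow> ((real \<Rightarrow> real) \<Rightarrow> real \<Rightarrow> real) \<Rightarrow> bool" where
  "contractive_on_Lp p X T \<longleftrightarrow>
     (\<exists>c. 0 \<le> c \<and> c < 1 \<and>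
       (\<forall>f\<in>Lp_space p X. \<forall>g\<in>Lp_space p X. Lp_dist p X (T f) (T g) \<le> c * Lp_dist p X f g))"

text \<open>Either end may be the open one, since an affine map onto \<open>{a..<b}\<close> may reverse orientation.\<close>

definition half_open_interval :: "real set \<Rightarrow> bool" where
  "half_open_interval X \<longleftrightarrow> (\<exists>a b. a < b \<and> (X = {a..<b} \<or> X = {a<..b}))"

text \<open>
  An affine map on a nondegenerate interval extends uniquely to the real line; it is identified
  with its extension, and only its inverse on the image of the interval is used.
\<close>

definition affine_map :: "(real \<Rightarrow> real) \<Rightarrow> bool" where
  "affine_map u \<longleftrightarrow> (\<exists>a b. \<forall>t. u t = a * t + b)"

text \<open>\<open>X\<close> together with its endpoint that \<open>u\<close> sends to \<open>1\<close>; the frontier of an interval consists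
  of its endpoints.\<close>

definition adjoin_endpoint :: "(real \<Rightarrow> real) \<Rightarrow> real set \<Rightarrow> real set" where
  "adjoin_endpoint u X = X \<union> {e \<in> frontier X. u e = 1}"

definition lipschitz_const :: "real set \<Rightarrow> (real \<Rightarrow> real) \<Rightarrow> real" where
  "lipschitz_const X u = Inf {L. L-lipschitz_on X u}"

definition RB_operator ::
  "nat \<Rightarrow> (nat \<Rightarrow> real set) \<Rightarrow> (nat \<Rightarrow> real \<Rightarrow> real) \<Rightarrow> (nat \<Rightarrow> real \<Rightarrow> real) \<Rightarrow>
   (nat \<Rightarrow> real \<Rightarrow> real) \<Rightarrow> (real \<Rightarrow> real) \<Rightarrow> real \<Rightarrow> real" where
  "RB_operator N X u lam S g = (\<lambda>y.
     (\<Sum>i=1..N. (lam i \<circ> inv_into (X i) (u i)) y * indicator (u i ` X i) y) +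
     (\<Sum>i=1..N. (S i \<circ> inv_into (X i) (u i)) y *
        (restrict g (X i) \<circ> inv_into (X i) (u i)) y * indicator (u i ` X i) y))"

definition contraction_condition ::
  "ennreal \<Rightarrow> nat \<Rightarrow> (nat \<Rightarrow> real set) \<Rightarrow> (nat \<Rightarrow> real \<Rightarrow> real) \<Rightarrow> (nat \<Rightarrow> real \<Rightarrow> real) \<Rightarrow> bool" where
  "contraction_condition p N X u S \<longleftrightarrow>
     (if p = \<infinity> then Max ((\<lambda>i. Linf_norm (X i) (S i)) ` {1..N}) < 1
      else if p < 1 then
        (\<Sum>i=1..N. lipschitz_const (X i) (u i) * Linf_norm (X i) (S i) powr enn2real p) < 1
      else
        (\<Sum>i=1..N. lipschitz_const (X i) (u i) * Linf_norm (X i) (S i) powr enn2real p)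
          powr (1 / enn2real p) < 1)"

end

theory Submission
  imports Defs
begin

text \<open>
  The operator $\Phi$ is a patchwork. On the piece $u_i(X_i)$ its value is
  $(\lambda_i + S_i g)\circ u_i^{-1}$, and $u_i^{-1}$ is an affine bijection onto $X_i$; the pieces
  are pairwise disjoint because the intervals of the partition are. Composition with an affine
  bijection preserves null sets and multiplies $p$-th power integrals by the Lipschitz constant
  $a_i$ of $u_i$.
  Therefore each summand lies in $L^p$, $\Phi$ respects equality almost everywhere
  (\<open>rb_in_Lp_space\<close>, \<open>rb_eq_ae\<close>), and, since at every point at most one summand is nonzero,
  \[ \int |\Phi f-\Phi g|^p
     = \sum_i a_i \int_{X_i} |S_i|^p|f-g|^p
     \le \Bigl(\sum_i a_i\|S_i\|_\infty^p\Bigr)\int_{[0,1]}|f-g|^p \]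
  (\<open>integral_rb_diff_le\<close>). The intervals $X_i$ may overlap: each of them contributes its own
  coefficient. For $p=\infty$ the same pointwise argument gives the factor $\max_i\|S_i\|_\infty$
  (\<open>Linf_norm_rb_diff_le\<close>). Taking a $p$-th root when $1\le p<\infty$ turns the estimate into a
  Lipschitz bound for the norm, so each of the three hypotheses makes $\Phi$ contractive in its
  range of exponents.

  The fixed point comes from a Banach theorem for $L^p$, valid for all $0<p\le\infty$
  (\<open>Lp_contraction_fixed_point\<close>), whose proof avoids both the triangle inequality and the
  completeness of $L^p$. Its engine is an equivalence between two forms of geometric decay:
  the distances of $f_n$ and $g_n$ in $L^p$ decay geometrically in $n$ iff almost everywhere
  $|f_n-g_n|\le H\rho^n$ for a single $H\in L^p$ and some $\rho<1$
  (\<open>Lp_dist_geometric_imp_AE\<close>, \<open>AE_geometric_imp_Lp_dist\<close>). The increments of the iterates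
  $F_n=T^n0$ decay in the first sense, hence in the second, so $F_n$ converges almost everywhere to
  some $f$ with $|F_n-f|\le H'\rho^n$. Going back, the distances from $F_n$ to $f$ decay
  geometrically, and by contractivity so do those from $F_{n+1}$ to $Tf$; going forth again,
  $F_{n+1}\to Tf$ almost everywhere. Hence $Tf=f$ almost everywhere.
\<close>

section \<open>The Lebesgue spaces\<close>

lemma enn2real_exponent_pos:
  assumes "0 < (p::ennreal)" "p \<noteq> \<infinity>"
  shows "0 < enn2real p"
  using assms by (simp add: enn2real_positive_iff less_top)

lemma Linf_norm_nonneg [simp]: "0 \<le> Linf_norm X f"
  by (simp add: Linf_norm_def)

lemma AE_Linf_norm:
  assumes "f \<in> Lp_space \<infinity> X"
  shows "AE t in lebesgue_on X. \<bar>f t\<bar> \<le> Linf_norm X f"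
proof -
  let ?s = "esssup (lebesgue_on X) (\<lambda>t. ennreal \<bar>f t\<bar>)"
  have "?s < \<infinity>" using assms by (simp add: Lp_space_def)
  then have s: "ennreal (Linf_norm X f) = ?s"
    unfolding Linf_norm_def by (intro ennreal_enn2real) auto
  have "AE t in lebesgue_on X. ennreal \<bar>f t\<bar> \<le> ?s" by (rule esssup_AE)
  then show ?thesis
    unfolding s[symmetric] by eventually_elim (simp add: Linf_norm_def)
qed

lemma
  assumes "f \<in> borel_measurable (lebesgue_on X)" "0 \<le> C" "AE t in lebesgue_on X. \<bar>f t\<bar> \<le> C"
  shows Linf_norm_le: "Linf_norm X f \<le> C"
    and Lp_space_infinityI: "f \<in> Lp_space \<infinity> X"
proof -
  have meas: "(\<lambda>t. ennreal \<bar>f t\<bar>) \<in> borel_measurable (lebesgue_on X)"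
    using assms(1) by measurable
  have le: "esssup (lebesgue_on X) (\<lambda>t. ennreal \<bar>f t\<bar>) \<le> ennreal C"
  proof (rule esssup_I[OF meas])
    show "AE t in lebesgue_on X. ennreal \<bar>f t\<bar> \<le> ennreal C"
      using assms(3) by eventually_elim (simp add: ennreal_leI)
  qed
  show "Linf_norm X f \<le> C"
    unfolding Linf_norm_def by (rule enn2real_leI[OF assms(2) le])
  show "f \<in> Lp_space \<infinity> X"
    using le assms(1) by (auto simp: Lp_space_def intro: order.strict_trans1)
qed

lemma Lp_space_measurable:
  "f \<in> Lp_space p X \<Longrightarrow> f \<in> borel_measurable (lebesgue_on X)"
  by (simp add: Lp_space_def)

text \<open>
  Domination reduces closure properties of $L^p$ to pointwise inequalities, which do not
  distinguish finite from infinite exponents; the constant absorbs essential bounds of factors.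
\<close>

lemma Lp_space_dominated:
  assumes f: "f \<in> borel_measurable (lebesgue_on X)" and g: "g \<in> Lp_space p X"
    and p: "0 < p" and C: "0 \<le> C"
    and le: "AE t in lebesgue_on X. \<bar>f t\<bar> \<le> C * \<bar>g t\<bar>"
  shows "f \<in> Lp_space p X"
proof (cases "p = \<infinity>")
  case True
  have "AE t in lebesgue_on X. \<bar>f t\<bar> \<le> C * Linf_norm X g"
    using le AE_Linf_norm[OF g[unfolded True]]
  proof eventually_elim
    case (elim t)
    then show ?case using mult_left_mono[OF elim(2) C] by linarith
  qed
  then show ?thesis
    unfolding True by (intro Lp_space_infinityI[OF f]) (auto simp: C)
next
  case False
  let ?q = "enn2real p"
  have q: "0 < ?q" using p False by (rule enn2real_exponent_pos)
  have "integrable (lebesgue_on X) (\<lambda>t. \<bar>g t\<bar> powr ?q)"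
    using g False by (simp add: Lp_space_def)
  then have int: "integrable (lebesgue_on X) (\<lambda>t. C powr ?q * \<bar>g t\<bar> powr ?q)"
    by simp
  have "AE t in lebesgue_on X. norm (\<bar>f t\<bar> powr ?q) \<le> norm (C powr ?q * \<bar>g t\<bar> powr ?q)"
    using le
  proof eventually_elim
    case (elim t)
    then have "\<bar>f t\<bar> powr ?q \<le> (C * \<bar>g t\<bar>) powr ?q" using q by (intro powr_mono2) auto
    then show ?case using C by (simp add: powr_mult)
  qed
  then have "integrable (lebesgue_on X) (\<lambda>t. \<bar>f t\<bar> powr ?q)"
    using f by (intro Bochner_Integration.integrable_bound[OF int]) measurable
  then show ?thesis using f False by (simp add: Lp_space_def)
qed

text \<open>
  The maximum serves sums and differences at once, and for all exponents: $|f\pm g|$ is at most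
  $2\max(|f|,|g|)$, while $\max(|f|,|g|)^p\le|f|^p+|g|^p$ also for $p<1$.
\<close>

lemma Lp_space_max_abs:
  assumes f: "f \<in> Lp_space p X" and g: "g \<in> Lp_space p X" and p: "0 < p"
  shows "(\<lambda>t. max \<bar>f t\<bar> \<bar>g t\<bar>) \<in> Lp_space p X"
proof -
  have fm[measurable]: "f \<in> borel_measurable (lebesgue_on X)"
    and gm[measurable]: "g \<in> borel_measurable (lebesgue_on X)"
    using f g by (auto dest: Lp_space_measurable)
  show ?thesis
  proof (cases "p = \<infinity>")
    case True
    have "AE t in lebesgue_on X. \<bar>max \<bar>f t\<bar> \<bar>g t\<bar>\<bar> \<le> max (Linf_norm X f) (Linf_norm X g)"
      using AE_Linf_norm[OF f[unfolded True]] AE_Linf_norm[OF g[unfolded True]]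
      by eventually_elim auto
    moreover have "(\<lambda>t. max \<bar>f t\<bar> \<bar>g t\<bar>) \<in> borel_measurable (lebesgue_on X)"
      by measurable
    ultimately show ?thesis
      unfolding True
      by (intro Lp_space_infinityI[of _ _ "max (Linf_norm X f) (Linf_norm X g)"])
         (simp_all only: le_max_iff_disj Linf_norm_nonneg simp_thms)
  next
    case False
    let ?q = "enn2real p"
    have "integrable (lebesgue_on X) (\<lambda>t. \<bar>f t\<bar> powr ?q + \<bar>g t\<bar> powr ?q)"
      using f g False by (intro Bochner_Integration.integrable_add) (auto simp: Lp_space_def)
    then have "integrable (lebesgue_on X) (\<lambda>t. \<bar>max \<bar>f t\<bar> \<bar>g t\<bar>\<bar> powr ?q)"
      by (rule Bochner_Integration.integrable_bound) (auto simp: max_def)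
    then show ?thesis using False by (simp add: Lp_space_def)
  qed
qed

lemma
  assumes f: "f \<in> Lp_space p X" and g: "g \<in> Lp_space p X" and p: "0 < p"
  shows Lp_space_add: "(\<lambda>t. f t + g t) \<in> Lp_space p X"
    and Lp_space_diff: "(\<lambda>t. f t - g t) \<in> Lp_space p X"
proof -
  have fm[measurable]: "f \<in> borel_measurable (lebesgue_on X)"
    and gm[measurable]: "g \<in> borel_measurable (lebesgue_on X)"
    using f g by (auto dest: Lp_space_measurable)
  note max = Lp_space_max_abs[OF f g p]
  show "(\<lambda>t. f t + g t) \<in> Lp_space p X"
    by (rule Lp_space_dominated[OF _ max p, of _ 2]) auto
  show "(\<lambda>t. f t - g t) \<in> Lp_space p X"
    by (rule Lp_space_dominated[OF _ max p, of _ 2]) auto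
qed

lemma Lp_space_zero: "(\<lambda>t. 0) \<in> Lp_space p X"
proof (cases "p = \<infinity>")
  case True
  then show ?thesis using Lp_space_infinityI[of "\<lambda>t. 0" X 0] by simp
qed (simp add: Lp_space_def)

lemma Lp_space_sum:
  assumes "finite I" "\<And>i. i \<in> I \<Longrightarrow> f i \<in> Lp_space p X" "0 < p"
  shows "(\<lambda>t. \<Sum>i\<in>I. f i t) \<in> Lp_space p X"
  using assms(1,2)
  by (induction I) (auto intro: Lp_space_zero Lp_space_add[OF _ _ assms(3)])

section \<open>Geometric decay in the mean and almost everywhere\<close>

lemma powr_power_swap: "0 \<le> (a::real) \<Longrightarrow> (a ^ n) powr q = (a powr q) ^ n"
  by (induction n) (auto simp: powr_mult)

lemma powr_lt_one: "0 \<le> a \<Longrightarrow> a < 1 \<Longrightarrow> 0 < q \<Longrightarrow> a powr q < (1::real)"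
  using powr_less_mono2[of q a 1] by simp

lemma Lp_dist_infinity: "Lp_dist \<infinity> X f g = Linf_norm X (\<lambda>t. f t - g t)"
  by (simp add: Lp_dist_def Lp_norm_def)

lemma Lp_dist_finite:
  assumes "p \<noteq> \<infinity>"
  shows "Lp_dist p X f g =
    (if p < 1 then (\<integral>t. \<bar>f t - g t\<bar> powr enn2real p \<partial>lebesgue_on X)
     else (\<integral>t. \<bar>f t - g t\<bar> powr enn2real p \<partial>lebesgue_on X) powr (1 / enn2real p))"
  using assms by (simp add: Lp_dist_def Lp_norm_def)

lemma Lp_dist_nonneg: "0 \<le> Lp_dist p X f g"
  by (simp add: Lp_dist_def Lp_norm_def)

text \<open>
  Passing from the distance to the integral of the $p$-th power removes the difference between
  $p<1$ (no root) and $p\ge1$ (a $p$-th root): both forms decay geometrically together.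
\<close>

lemma integral_powr_le_of_Lp_dist:
  fixes f g :: "nat \<Rightarrow> real \<Rightarrow> real"
  assumes p: "0 < p" "p \<noteq> \<infinity>" and c: "0 \<le> c" "c < 1" and C: "0 \<le> C"
    and le: "\<And>n. Lp_dist p X (f n) (g n) \<le> C * c ^ n"
  obtains K k where "0 \<le> K" "0 \<le> k" "k < 1"
    "\<forall>n. (\<integral>t. \<bar>f n t - g n t\<bar> powr enn2real p \<partial>lebesgue_on X) \<le> K * k ^ n"
proof (cases "p < 1")
  case True
  then show ?thesis using le p c C by (intro that[of C c]) (auto simp: Lp_dist_finite)
next
  case False
  let ?q = "enn2real p"
  have q: "0 < ?q" using p by (rule enn2real_exponent_pos)
  have "(\<integral>t. \<bar>f n t - g n t\<bar> powr ?q \<partial>lebesgue_on X) \<le> C powr ?q * (c powr ?q) ^ n" for n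
  proof -
    let ?E = "\<integral>t. \<bar>f n t - g n t\<bar> powr ?q \<partial>lebesgue_on X"
    have E: "0 \<le> ?E" by simp
    have "?E = (?E powr (1 / ?q)) powr ?q" using q E by (simp add: powr_powr)
    also have "\<dots> \<le> (C * c ^ n) powr ?q"
      using le[of n] False p q by (intro powr_mono2) (auto simp: Lp_dist_finite)
    also have "\<dots> = C powr ?q * (c powr ?q) ^ n"
      using C c by (simp add: powr_mult powr_power_swap)
    finally show ?thesis .
  qed
  then show ?thesis using powr_lt_one[OF c q] by (intro that[of "C powr ?q" "c powr ?q"]) auto
qed

text \<open>
  Put $h_n=|f_n-g_n|$. If $\int h_n^p\le Kk^n$ and $k<s<1$, then
  $G=\sum_n h_n^p/s^n$ has integral at most $K\sum_n(k/s)^n<\infty$, so $G$ is finite almost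
  everywhere. Since every term is at most the sum, $h_n\le G^{1/p}(s^{1/p})^n$ for all $n$
  simultaneously, and $G^{1/p}$ lies in $L^p$. Summing $p$-th powers rather than the $h_n$ makes
  monotone convergence sufficient, with no triangle inequality, for every finite $p$. The case
  $p=\infty$ holds with a constant majorant.
\<close>

lemma Lp_dist_geometric_imp_AE:
  assumes p: "0 < p" and c: "0 \<le> c" "c < 1" and C: "0 \<le> C"
    and f: "\<And>n. f n \<in> Lp_space p X" and g: "\<And>n. g n \<in> Lp_space p X"
    and le: "\<And>n. Lp_dist p X (f n) (g n) \<le> C * c ^ n"
  obtains H \<rho> where "H \<in> Lp_space p X" "\<forall>t. 0 \<le> H t" "0 \<le> \<rho>" "\<rho> < 1"
    "AE t in lebesgue_on X. \<forall>n. \<bar>f n t - g n t\<bar> \<le> H t * \<rho> ^ n"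
proof (cases "p = \<infinity>")
  case True
  have diff: "(\<lambda>t. f n t - g n t) \<in> Lp_space \<infinity> X" for n
    using Lp_space_diff[OF f g p] True by simp
  have "AE t in lebesgue_on X. \<bar>f n t - g n t\<bar> \<le> C * c ^ n" for n
    using AE_Linf_norm[OF diff[of n]] by eventually_elim (use le[of n] in \<open>simp add: True Lp_dist_infinity del: infinity_ennreal_def\<close>)
  then have "AE t in lebesgue_on X. \<forall>n. \<bar>f n t - g n t\<bar> \<le> C * c ^ n"
    by (simp add: AE_all_countable)
  moreover have "(\<lambda>t. C) \<in> Lp_space p X"
    unfolding True by (rule Lp_space_infinityI[of _ _ C]) (use C in auto)
  ultimately show ?thesis
    using c C by (intro that[of "\<lambda>t. C" c]) auto
next
  case False
  let ?q = "enn2real p" and ?M = "lebesgue_on X"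
  have q: "0 < ?q" using p False by (rule enn2real_exponent_pos)
  obtain K k where K: "0 \<le> K" and k: "0 \<le> k" "k < 1"
    and E: "\<forall>n. (\<integral>t. \<bar>f n t - g n t\<bar> powr ?q \<partial>?M) \<le> K * k ^ n"
    by (rule integral_powr_le_of_Lp_dist[where f = f and g = g, OF p False c C le])
  \<comment> \<open>Any number strictly between k and 1 would do; it is positive even if k vanishes.\<close>
  define s where "s = (1 + k) / 2"
  have s: "0 < s" "k < s" "s < 1" using k by (auto simp: s_def)
  define r where "r n t = \<bar>f n t - g n t\<bar> powr ?q / s ^ n" for n t
  define G where "G t = (\<Sum>n. ennreal (r n t))" for t
  have [measurable]: "f n \<in> borel_measurable ?M" "g n \<in> borel_measurable ?M" for n
    using f g by (auto dest: Lp_space_measurable)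
  have r_meas[measurable]: "r n \<in> borel_measurable ?M" for n
    unfolding r_def by measurable
  have r0: "0 \<le> r n t" for n t using s by (simp add: r_def)
  have G_meas[measurable]: "G \<in> borel_measurable ?M" unfolding G_def by measurable
  have int: "integrable ?M (\<lambda>t. \<bar>f n t - g n t\<bar> powr ?q)" for n
    using Lp_space_diff[OF f g p] False by (simp add: Lp_space_def)
  have "(\<integral>\<^sup>+t. r n t \<partial>?M) \<le> ennreal (K * (k / s) ^ n)" for n
  proof -
    have "(\<integral>\<^sup>+t. r n t \<partial>?M) = ennreal (\<integral>t. r n t \<partial>?M)"
      using int[of n] r0 by (intro nn_integral_eq_integral) (auto simp: r_def)
    also have "(\<integral>t. r n t \<partial>?M) = (\<integral>t. \<bar>f n t - g n t\<bar> powr ?q \<partial>?M) / s ^ n"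
      by (simp add: r_def)
    also have "\<dots> \<le> K * (k / s) ^ n"
      using E s by (simp add: power_divide divide_right_mono)
    finally show ?thesis by (simp add: ennreal_leI)
  qed
  then have "(\<integral>\<^sup>+t. G t \<partial>?M) \<le> (\<Sum>n. ennreal (K * (k / s) ^ n))"
    unfolding G_def by (subst nn_integral_suminf) (auto intro!: suminf_le)
  also have "\<dots> < \<infinity>"
  proof -
    have "summable (\<lambda>n. K * (k / s) ^ n)" using s k by (intro summable_mult summable_geometric) auto
    then show ?thesis using K k s by (subst suminf_ennreal2) auto
  qed
  finally have fin: "(\<integral>\<^sup>+t. G t \<partial>?M) < \<infinity>" .
  then have AE_fin: "AE t in ?M. G t \<noteq> \<infinity>"
    by (intro nn_integral_PInf_AE) auto
  define H where "H t = enn2real (G t) powr (1 / ?q)" for t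
  have H_powr: "\<bar>H t\<bar> powr ?q = enn2real (G t)" for t
    using q by (simp add: H_def powr_powr)
  have "integrable ?M (\<lambda>t. enn2real (G t))"
  proof (rule integrableI_nonneg)
    have "(\<integral>\<^sup>+t. ennreal (enn2real (G t)) \<partial>?M) \<le> (\<integral>\<^sup>+t. G t \<partial>?M)"
      by (intro nn_integral_mono) (simp add: ennreal_enn2real_if)
    then show "(\<integral>\<^sup>+t. ennreal (enn2real (G t)) \<partial>?M) < \<infinity>" using fin by (rule order.strict_trans1)
  qed auto
  moreover have "H \<in> borel_measurable ?M"
    unfolding H_def[abs_def] by measurable
  ultimately have H: "H \<in> Lp_space p X"
    using False by (simp add: Lp_space_def H_powr)
  have "AE t in ?M. \<forall>n. \<bar>f n t - g n t\<bar> \<le> H t * (s powr (1 / ?q)) ^ n"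
    using AE_fin
  proof eventually_elim
    case (elim t)
    show ?case
    proof
      fix n
      have "ennreal (r n t) \<le> G t"
        unfolding G_def using sum_le_suminf[of "\<lambda>n. ennreal (r n t)" "{n}"] by simp
      then have "r n t \<le> enn2real (G t)"
        using enn2real_mono[of "ennreal (r n t)" "G t"] elim r0 by (simp add: less_top)
      then have "\<bar>f n t - g n t\<bar> powr ?q \<le> enn2real (G t) * s ^ n"
        using s by (simp add: r_def divide_simps)
      then have "(\<bar>f n t - g n t\<bar> powr ?q) powr (1 / ?q) \<le> (enn2real (G t) * s ^ n) powr (1 / ?q)"
        using q by (intro powr_mono2) auto
      then show "\<bar>f n t - g n t\<bar> \<le> H t * (s powr (1 / ?q)) ^ n"
        using q s by (simp add: powr_powr powr_mult powr_power_swap H_def)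
    qed
  qed
  then show ?thesis
    using H q s by (intro that[of H "s powr (1 / ?q)"]) (auto simp: H_def intro!: powr_lt_one)
qed

text \<open>
  The converse direction is an integration of the pointwise bound: $\int|f_n-g_n|^p$ is at most
  $(\rho^p)^n\int H^p$.
\<close>

lemma AE_geometric_imp_Lp_dist:
  assumes p: "0 < p" and \<rho>: "0 \<le> \<rho>" "\<rho> < 1"
    and f: "\<And>n. f n \<in> Lp_space p X" and g: "\<And>n. g n \<in> Lp_space p X"
    and H: "H \<in> Lp_space p X" "\<And>t. 0 \<le> H t"
    and le: "AE t in lebesgue_on X. \<forall>n. \<bar>f n t - g n t\<bar> \<le> H t * \<rho> ^ n"
  obtains C c where "0 \<le> C" "0 \<le> c" "c < 1" "\<forall>n. Lp_dist p X (f n) (g n) \<le> C * c ^ n"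
proof (cases "p = \<infinity>")
  case True
  have "Lp_dist p X (f n) (g n) \<le> Linf_norm X H * \<rho> ^ n" for n
    unfolding True Lp_dist_infinity
  proof (rule Linf_norm_le)
    show "(\<lambda>t. f n t - g n t) \<in> borel_measurable (lebesgue_on X)"
      by (rule Lp_space_measurable[OF Lp_space_diff[OF f g p]])
    show "0 \<le> Linf_norm X H * \<rho> ^ n" using \<rho> by simp
    show "AE t in lebesgue_on X. \<bar>f n t - g n t\<bar> \<le> Linf_norm X H * \<rho> ^ n"
      using le AE_Linf_norm[OF H(1)[unfolded True]]
    proof eventually_elim
      case (elim t)
      have "H t * \<rho> ^ n \<le> Linf_norm X H * \<rho> ^ n"
        using elim(2) \<rho> by (intro mult_right_mono) auto
      then show ?case using elim(1) by (meson order.trans)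
    qed
  qed
  then show ?thesis using \<rho> by (intro that[of "Linf_norm X H" \<rho>]) auto
next
  case False
  let ?q = "enn2real p" and ?M = "lebesgue_on X"
  have q: "0 < ?q" using p False by (rule enn2real_exponent_pos)
  let ?K = "\<integral>t. \<bar>H t\<bar> powr ?q \<partial>?M" and ?k = "\<rho> powr ?q"
  have E: "(\<integral>t. \<bar>f n t - g n t\<bar> powr ?q \<partial>?M) \<le> ?K * ?k ^ n" for n
  proof -
    have "(\<integral>t. \<bar>f n t - g n t\<bar> powr ?q \<partial>?M) \<le> (\<integral>t. \<bar>H t\<bar> powr ?q * ?k ^ n \<partial>?M)"
    proof (rule integral_mono_AE)
      show "integrable ?M (\<lambda>t. \<bar>f n t - g n t\<bar> powr ?q)"
        using Lp_space_diff[OF f g p] False by (simp add: Lp_space_def)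
      show "integrable ?M (\<lambda>t. \<bar>H t\<bar> powr ?q * ?k ^ n)"
        using H False by (simp add: Lp_space_def)
      show "AE t in ?M. \<bar>f n t - g n t\<bar> powr ?q \<le> \<bar>H t\<bar> powr ?q * ?k ^ n"
        using le
      proof eventually_elim
        case (elim t)
        have "\<bar>f n t - g n t\<bar> powr ?q \<le> (H t * \<rho> ^ n) powr ?q"
          using elim q by (intro powr_mono2) auto
        then show ?case using H(2)[of t] \<rho> by (simp add: powr_mult powr_power_swap)
      qed
    qed
    then show ?thesis by simp
  qed
  show ?thesis
  proof (cases "p < 1")
    case True
    then show ?thesis
      using E \<rho> q powr_lt_one[OF \<rho> q] False
      by (intro that[of ?K ?k]) (auto simp: Lp_dist_finite)
  next
    case p1: False
    have "Lp_dist p X (f n) (g n) \<le> ?K powr (1 / ?q) * \<rho> ^ n" for n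
    proof -
      have "Lp_dist p X (f n) (g n) \<le> (?K * ?k ^ n) powr (1 / ?q)"
        using p1 False E[of n] q by (simp add: Lp_dist_finite powr_mono2)
      then show ?thesis using \<rho> q by (simp add: powr_mult powr_power_swap powr_powr)
    qed
    then show ?thesis using \<rho> by (intro that[of "?K powr (1 / ?q)" \<rho>]) auto
  qed
qed

section \<open>Contractions of Lebesgue spaces\<close>

lemma geometric_increments_limit:
  fixes a :: "nat \<Rightarrow> real"
  assumes \<rho>: "0 \<le> \<rho>" "\<rho> < 1" and le: "\<And>n. \<bar>a (Suc n) - a n\<bar> \<le> h * \<rho> ^ n"
  shows "a \<longlonglongrightarrow> lim a" "\<And>n. \<bar>a n - lim a\<bar> \<le> h / (1 - \<rho>) * \<rho> ^ n"
proof -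
  have sum_le: "\<bar>a (n + m) - a n\<bar> \<le> h / (1 - \<rho>) * \<rho> ^ n" for n m
  proof -
    have h: "0 \<le> h" using le[of 0] by simp
    have "\<bar>a (n + m) - a n\<bar> \<le> h * \<rho> ^ n * (\<Sum>j<m. \<rho> ^ j)"
    proof (induction m)
      case (Suc m)
      have "\<bar>a (n + Suc m) - a n\<bar> \<le> \<bar>a (Suc (n + m)) - a (n + m)\<bar> + \<bar>a (n + m) - a n\<bar>" by simp
      also have "\<dots> \<le> h * \<rho> ^ (n + m) + h * \<rho> ^ n * (\<Sum>j<m. \<rho> ^ j)"
        using le Suc by (intro add_mono)
      finally show ?case by (simp add: algebra_simps power_add)
    qed simp
    also have "\<dots> \<le> h * \<rho> ^ n * (1 / (1 - \<rho>))"
    proof (rule mult_left_mono)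
      show "(\<Sum>j<m. \<rho> ^ j) \<le> 1 / (1 - \<rho>)"
        using \<rho> sum_le_suminf[of "\<lambda>j. \<rho> ^ j" "{..<m}"]
        by (simp add: suminf_geometric summable_geometric)
    qed (use h \<rho> in simp)
    finally show ?thesis by simp
  qed
  have "summable (\<lambda>n. a (Suc n) - a n)"
    by (rule summable_comparison_test'[of "\<lambda>n. h * \<rho> ^ n" 0])
       (use le \<rho> in \<open>auto intro!: summable_mult summable_geometric\<close>)
  then have "convergent (\<lambda>n. a n - a 0)"
    by (simp add: summable_iff_convergent sum_lessThan_telescope)
  then have "convergent a" by (simp add: convergent_diff_const_right_iff)
  then show lim: "a \<longlonglongrightarrow> lim a" by (simp add: convergent_LIMSEQ_iff)
  show "\<bar>a n - lim a\<bar> \<le> h / (1 - \<rho>) * \<rho> ^ n" for n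
  proof -
    have "(\<lambda>m. \<bar>a (m + n) - a n\<bar>) \<longlonglongrightarrow> \<bar>lim a - a n\<bar>"
      by (intro tendsto_intros LIMSEQ_ignore_initial_segment lim)
    then have "\<bar>lim a - a n\<bar> \<le> h / (1 - \<rho>) * \<rho> ^ n"
      by (rule LIMSEQ_le_const2) (use sum_le[of n] in \<open>auto simp: add.commute\<close>)
    then show ?thesis by (simp add: abs_minus_commute)
  qed
qed


text \<open>
  The distance depends only on classes modulo equality almost everywhere. This is what uniqueness
  of the fixed point needs, because a fixed point of an operator on classes is fixed by its
  representing map only almost everywhere.
\<close>

lemma Lp_dist_cong_AE:
  assumes meas: "f \<in> borel_measurable (lebesgue_on X)" "g \<in> borel_measurable (lebesgue_on X)"
      "f' \<in> borel_measurable (lebesgue_on X)" "g' \<in> borel_measurable (lebesgue_on X)"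
    and eq: "eq_ae X f f'" "eq_ae X g g'"
  shows "Lp_dist p X f g = Lp_dist p X f' g'"
proof -
  have ae: "AE t in lebesgue_on X. f t - g t = f' t - g' t"
    using eq unfolding eq_ae_def by eventually_elim simp
  have "esssup (lebesgue_on X) (\<lambda>t. ennreal \<bar>f t - g t\<bar>) =
      esssup (lebesgue_on X) (\<lambda>t. ennreal \<bar>f' t - g' t\<bar>)"
    using meas by (intro esssup_AE_cong) (use ae in \<open>auto\<close>)
  moreover have "(\<integral>t. \<bar>f t - g t\<bar> powr enn2real p \<partial>lebesgue_on X) =
      (\<integral>t. \<bar>f' t - g' t\<bar> powr enn2real p \<partial>lebesgue_on X)"
    using meas by (intro integral_cong_AE) (use ae in \<open>auto\<close>)
  ultimately show ?thesis by (simp add: Lp_dist_def Lp_norm_def Linf_norm_def)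
qed

text \<open>
  Banach's theorem for the iterates of the zero function, alternating between the two forms of
  geometric decay: contractivity acts on distances, convergence is read off almost everywhere.
\<close>

theorem Lp_contraction_fixed_point:
  assumes p: "0 < p" and T: "\<And>f. f \<in> Lp_space p X \<Longrightarrow> T f \<in> Lp_space p X"
    and contr: "contractive_on_Lp p X T"
  shows "\<exists>f\<in>Lp_space p X. eq_ae X (T f) f \<and>
    (\<forall>g\<in>Lp_space p X. eq_ae X (T g) g \<longrightarrow> eq_ae X g f)"
proof -
  let ?L = "Lp_space p X" and ?M = "lebesgue_on X"
  obtain c where c: "0 \<le> c" "c < 1"
    and T_le: "\<And>f g. f \<in> ?L \<Longrightarrow> g \<in> ?L \<Longrightarrow> Lp_dist p X (T f) (T g) \<le> c * Lp_dist p X f g"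
    using contr unfolding contractive_on_Lp_def by metis
  define F where "F n = (T ^^ n) (\<lambda>t. 0)" for n
  have F_Suc: "F (Suc n) = T (F n)" for n by (simp add: F_def)
  have F: "F n \<in> ?L" for n
    by (induction n) (simp add: F_def Lp_space_zero, simp add: F_Suc T)
  have F_meas[measurable]: "F n \<in> borel_measurable ?M" for n
    using F by (rule Lp_space_measurable)
  have dist_Suc: "Lp_dist p X (F (Suc n)) (F n) \<le> Lp_dist p X (F 1) (F 0) * c ^ n" for n
  proof (induction n)
    case (Suc n)
    have "Lp_dist p X (F (Suc (Suc n))) (F (Suc n)) \<le> c * Lp_dist p X (F (Suc n)) (F n)"
      using T_le[OF F[of "Suc n"] F[of n]] by (simp add: F_Suc)
    also have "\<dots> \<le> c * (Lp_dist p X (F 1) (F 0) * c ^ n)"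
      using Suc c by (intro mult_left_mono)
    finally show ?case by (simp add: algebra_simps)
  qed simp
  obtain H \<rho> where H: "H \<in> ?L" "\<forall>t. 0 \<le> H t" and \<rho>: "0 \<le> \<rho>" "\<rho> < 1"
    and step: "AE t in ?M. \<forall>n. \<bar>F (Suc n) t - F n t\<bar> \<le> H t * \<rho> ^ n"
    by (rule Lp_dist_geometric_imp_AE[where f = "\<lambda>n. F (Suc n)" and g = F,
          OF p c Lp_dist_nonneg F F dist_Suc])
  define f where "f t = lim (\<lambda>n. F n t)" for t
  have f_meas: "f \<in> borel_measurable ?M" unfolding f_def[abs_def] by measurable
  \<comment> \<open>The tail of the geometric series starting at n adds the factor 1 / (1 - rho).\<close>
  define H' where "H' t = H t / (1 - \<rho>)" for t
  have lim: "AE t in ?M. (\<lambda>n. F n t) \<longlonglongrightarrow> f t"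
    using step unfolding f_def
  proof eventually_elim
    case (elim t)
    show ?case by (rule geometric_increments_limit(1)[OF \<rho>]) (use elim in blast)
  qed
  have rate: "AE t in ?M. \<forall>n. \<bar>F n t - f t\<bar> \<le> H' t * \<rho> ^ n"
    using step unfolding f_def H'_def
  proof eventually_elim
    case (elim t)
    show ?case by (intro allI geometric_increments_limit(2)[OF \<rho>]) (use elim in blast)
  qed
  have H': "H' \<in> ?L"
  proof (rule Lp_space_dominated[OF _ H(1) p])
    show "H' \<in> borel_measurable ?M"
      using Lp_space_measurable[OF H(1)] unfolding H'_def[abs_def] by measurable
    show "0 \<le> 1 / (1 - \<rho>)" using \<rho> by simp
    show "AE t in ?M. \<bar>H' t\<bar> \<le> 1 / (1 - \<rho>) * \<bar>H t\<bar>" using \<rho> by (simp add: H'_def)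
  qed
  have H'0: "0 \<le> H' t" for t using H(2) \<rho> by (simp add: H'_def)
  have f: "f \<in> ?L"
  proof (rule Lp_space_dominated[OF f_meas H' p, of 1])
    \<comment> \<open>The start at zero turns the rate at n = 0 into a bound for the limit itself.\<close>
    show "AE t in ?M. \<bar>f t\<bar> \<le> 1 * \<bar>H' t\<bar>"
      using rate
    proof eventually_elim
      case (elim t)
      then show ?case using elim[rule_format, of 0] by (simp add: F_def)
    qed
  qed simp
  obtain C k where C: "0 \<le> C" and k: "0 \<le> k" "k < 1"
    and dist_le: "\<forall>n. Lp_dist p X (F n) f \<le> C * k ^ n"
    by (rule AE_geometric_imp_Lp_dist[where f = F and g = "\<lambda>n. f", OF p \<rho> F f H' H'0 rate])
  have dist_Tf: "Lp_dist p X (F (Suc n)) (T f) \<le> C * k ^ n" for n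
  proof -
    have "Lp_dist p X (F (Suc n)) (T f) \<le> c * Lp_dist p X (F n) f"
      using T_le[OF F f] by (simp add: F_Suc)
    also have "\<dots> \<le> 1 * Lp_dist p X (F n) f"
      using c Lp_dist_nonneg by (intro mult_right_mono) auto
    also have "\<dots> \<le> C * k ^ n" using dist_le by simp
    finally show ?thesis .
  qed
  obtain J \<sigma> where \<sigma>: "0 \<le> \<sigma>" "\<sigma> < 1"
    and J: "AE t in ?M. \<forall>n. \<bar>F (Suc n) t - T f t\<bar> \<le> J t * \<sigma> ^ n"
    by (rule Lp_dist_geometric_imp_AE[where f = "\<lambda>n. F (Suc n)" and g = "\<lambda>n. T f",
          OF p k C F T[OF f] dist_Tf])
  have "eq_ae X (T f) f"
    unfolding eq_ae_def using lim J
  proof eventually_elim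
    case (elim t)
    have "(\<lambda>n. J t * \<sigma> ^ n) \<longlonglongrightarrow> J t * 0"
      using \<sigma> by (intro tendsto_mult_left LIMSEQ_power_zero) simp
    then have J0: "(\<lambda>n. J t * \<sigma> ^ n) \<longlonglongrightarrow> 0" by simp
    have "(\<lambda>n. F (Suc n) t - T f t) \<longlonglongrightarrow> 0"
      by (rule Lim_null_comparison[OF always_eventually J0]) (use elim(2) in simp)
    then have "(\<lambda>n. F (Suc n) t) \<longlonglongrightarrow> T f t" by (simp add: LIM_zero_iff)
    then show ?case using LIMSEQ_Suc[OF elim(1)] by (rule LIMSEQ_unique)
  qed
  moreover have "eq_ae X g f" if g: "g \<in> ?L" "eq_ae X (T g) g" for g
  proof -
    note f_fix = \<open>eq_ae X (T f) f\<close>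
    have "Lp_dist p X g f = Lp_dist p X (T g) (T f)"
    proof (rule Lp_dist_cong_AE)
      show "eq_ae X g (T g)" "eq_ae X f (T f)"
        using g(2) f_fix unfolding eq_ae_def by (auto elim: eventually_mono)
    qed (intro Lp_space_measurable[of _ p] T f g(1))+
    then have "Lp_dist p X g f \<le> c * Lp_dist p X g f"
      using T_le[OF g(1) f] by simp
    then have "(1 - c) * Lp_dist p X g f \<le> 0" by (simp add: algebra_simps)
    then have zero: "Lp_dist p X g f \<le> 0 * c ^ n" for n using c by (simp add: mult_le_0_iff)
    \<comment> \<open>A vanishing distance is a geometric decay of a constant sequence, so that
      the pointwise majorant tends to 0 and forces equality.\<close>
    obtain K \<sigma> where \<sigma>: "0 \<le> \<sigma>" "\<sigma> < 1"
      and K: "AE t in ?M. \<forall>n. \<bar>g t - f t\<bar> \<le> K t * \<sigma> ^ n"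
      by (rule Lp_dist_geometric_imp_AE[where f = "\<lambda>n. g" and g = "\<lambda>n. f",
            OF p c order.refl g(1) f zero])
    show ?thesis
      unfolding eq_ae_def using K
    proof eventually_elim
      case (elim t)
      have "(\<lambda>n. K t * \<sigma> ^ n) \<longlonglongrightarrow> K t * 0"
        using \<sigma> by (intro tendsto_mult_left LIMSEQ_power_zero) simp
      then have "\<bar>g t - f t\<bar> \<le> K t * 0"
        by (rule LIMSEQ_le_const) (use elim in auto)
      then show ?case by simp
    qed
  qed
  ultimately show ?thesis using f by blast
qed

section \<open>Affine changes of variables\<close>

lemma affine_measurable_lebesgue:
  fixes c d :: real
  assumes "c \<noteq> 0"
  shows "(\<lambda>y. d + c * y) \<in> lebesgue \<rightarrow>\<^sub>M lebesgue"
  using lebesgue_affine_measurable[where c = "\<lambda>x::real. c" and t = d] assms by simp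

text \<open>
  Lebesgue measure is, up to the factor $|c|$, its own image under $y\mapsto d+cy$; hence preimages
  of null sets are null.
\<close>

lemma AE_affine_pullback:
  fixes c d :: real
  assumes c: "c \<noteq> 0" and P: "AE t in lebesgue. P t"
  shows "AE y in lebesgue. P (d + c * y)"
proof -
  obtain N where N: "{t. \<not> P t} \<subseteq> N" "N \<in> null_sets lebesgue"
    using P by (auto simp: eventually_ae_filter)
  have "AE t in density (distr lebesgue lebesgue (\<lambda>y. d + c * y)) (\<lambda>_. ennreal \<bar>c\<bar>). t \<notin> N"
    using AE_not_in[OF N(2)] by (subst (asm) lebesgue_real_affine[OF c, of d])
  then have "AE t in distr lebesgue lebesgue (\<lambda>y. d + c * y). t \<notin> N"
    using c by (subst (asm) AE_density) auto
  then have "AE y in lebesgue. d + c * y \<notin> N"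
    using AE_distrD[OF affine_measurable_lebesgue[OF c]] by blast
  then show ?thesis
    by eventually_elim (use N(1) in blast)
qed

lemma AE_affine_pullback_on:
  fixes c d :: real
  assumes "c \<noteq> 0" "X \<in> sets lebesgue" "AE t in lebesgue_on X. P t"
  shows "AE y in lebesgue. d + c * y \<in> X \<longrightarrow> P (d + c * y)"
  using assms by (intro AE_affine_pullback) (simp_all add: AE_restrict_space_iff)

lemma AE_lebesgue_imp_lebesgue_on:
  assumes "Y \<in> sets lebesgue" "AE y in lebesgue. P y"
  shows "AE y in lebesgue_on Y. P y"
  using assms by (auto simp: AE_restrict_space_iff)

lemma nn_integral_affine_pullback:
  fixes c d :: real and F :: "real \<Rightarrow> ennreal"
  assumes c: "c \<noteq> 0" and X: "X \<in> sets lebesgue" and F: "F \<in> borel_measurable (lebesgue_on X)"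
  shows "(\<integral>\<^sup>+y. F (d + c * y) * indicator X (d + c * y) \<partial>lebesgue) =
    ennreal (1 / \<bar>c\<bar>) * (\<integral>\<^sup>+t. F t \<partial>lebesgue_on X)"
proof -
  have meas: "(\<lambda>t. F t * indicator X t) \<in> borel_measurable lebesgue"
    using F X by (simp add: borel_measurable_restrict_space_iff_ennreal)
  have "(\<integral>\<^sup>+t. F t \<partial>lebesgue_on X) = (\<integral>\<^sup>+t. F t * indicator X t \<partial>lebesgue)"
    using X by (simp add: nn_integral_restrict_space)
  also have "\<dots> = ennreal \<bar>c\<bar> * (\<integral>\<^sup>+y. F (d + c * y) * indicator X (d + c * y) \<partial>lebesgue)"
    by (rule nn_integral_real_affine_lebesgue[OF meas c])
  finally show ?thesis
    using c by (simp add: mult.assoc[symmetric] ennreal_mult[symmetric])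
qed

lemma borel_measurable_affine_pullback:
  fixes f :: "real \<Rightarrow> real"
  assumes c: "c \<noteq> 0" and X: "X \<in> sets lebesgue" and f: "f \<in> borel_measurable (lebesgue_on X)"
  shows "(\<lambda>y. f (d + c * y) * indicator X (d + c * y)) \<in> borel_measurable lebesgue"
proof -
  have "(\<lambda>t. indicator X t *\<^sub>R f t) \<in> borel_measurable lebesgue"
    using f X by (simp add: borel_measurable_restrict_space_iff)
  then have "(\<lambda>y. indicator X (d + c * y) *\<^sub>R f (d + c * y)) \<in> borel_measurable lebesgue"
    using measurable_compose[OF affine_measurable_lebesgue[OF c]] by blast
  then show ?thesis by (simp add: mult.commute)
qed

text \<open>
  The pullback is extended by zero outside the preimage of \<open>X\<close>, so that the pieces of the operator
  become functions on one common domain and can be added.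
\<close>

lemma Lp_space_affine_pullback:
  assumes c: "c \<noteq> 0" and X: "X \<in> sets lebesgue" and Y: "Y \<in> sets lebesgue"
    and f: "f \<in> Lp_space p X"
  shows "(\<lambda>y. f (d + c * y) * indicator X (d + c * y)) \<in> Lp_space p Y"
proof -
  have f_meas[measurable]: "f \<in> borel_measurable (lebesgue_on X)"
    using f by (rule Lp_space_measurable)
  have meas: "(\<lambda>y. f (d + c * y) * indicator X (d + c * y)) \<in> borel_measurable (lebesgue_on Y)"
    by (rule measurable_restrict_space1[OF borel_measurable_affine_pullback[OF c X f_meas]])
  show ?thesis
  proof (cases "p = \<infinity>")
    case True
    have "AE y in lebesgue_on Y. d + c * y \<in> X \<longrightarrow> \<bar>f (d + c * y)\<bar> \<le> Linf_norm X f"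
      by (intro AE_lebesgue_imp_lebesgue_on[OF Y] AE_affine_pullback_on[OF c X]
          AE_Linf_norm[OF f[unfolded True]])
    then have "AE y in lebesgue_on Y. \<bar>f (d + c * y) * indicator X (d + c * y)\<bar> \<le> Linf_norm X f"
      by eventually_elim (auto simp: indicator_def)
    then show ?thesis
      unfolding True by (rule Lp_space_infinityI[OF meas Linf_norm_nonneg])
  next
    case False
    let ?q = "enn2real p"
    let ?g = "\<lambda>y. \<bar>f (d + c * y) * indicator X (d + c * y)\<bar> powr ?q"
    have "(\<integral>\<^sup>+y. ?g y \<partial>lebesgue_on Y) \<le> (\<integral>\<^sup>+y. ?g y \<partial>lebesgue)"
      using Y by (subst nn_integral_restrict_space) (auto intro!: nn_integral_mono simp: indicator_def)
    also have "\<dots> = (\<integral>\<^sup>+y. ennreal (\<bar>f (d + c * y)\<bar> powr ?q) * indicator X (d + c * y) \<partial>lebesgue)"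
      by (intro nn_integral_cong) (simp add: indicator_def)
    also have "\<dots> = ennreal (1 / \<bar>c\<bar>) * (\<integral>\<^sup>+t. \<bar>f t\<bar> powr ?q \<partial>lebesgue_on X)"
      by (rule nn_integral_affine_pullback[OF c X]) measurable
    also have "\<dots> < \<infinity>"
      using f False by (simp add: Lp_space_def nn_integral_eq_integral ennreal_mult_less_top)
    finally have "integrable (lebesgue_on Y) ?g"
      using meas by (intro integrableI_nonneg) auto
    then show ?thesis using meas False by (simp add: Lp_space_def)
  qed
qed

text \<open>
  Restriction to a subset is the affine pullback along the identity.
\<close>

lemma Lp_space_subset:
  assumes f: "f \<in> Lp_space p Y" and XY: "X \<subseteq> Y" and p: "0 < p"
    and X: "X \<in> sets lebesgue" and Y: "Y \<in> sets lebesgue"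
  shows "f \<in> Lp_space p X"
proof (rule Lp_space_dominated[OF _ _ p, of _ _ _ 1])
  show "(\<lambda>t. f (0 + 1 * t) * indicator Y (0 + 1 * t)) \<in> Lp_space p X"
    by (rule Lp_space_affine_pullback[OF _ Y X f]) simp
  show "f \<in> borel_measurable (lebesgue_on X)"
    using measurable_restrict_mono[OF Lp_space_measurable[OF f] XY] .
  show "AE t in lebesgue_on X. \<bar>f t\<bar> \<le> 1 * \<bar>f (0 + 1 * t) * indicator Y (0 + 1 * t)\<bar>"
    using XY by (intro AE_I2) (auto simp: space_restrict_space)
qed simp

lemma Lp_space_mult_Linf:
  assumes S: "S \<in> Lp_space \<infinity> X" and g: "g \<in> Lp_space p X" and p: "0 < p"
  shows "(\<lambda>t. S t * g t) \<in> Lp_space p X"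
proof (rule Lp_space_dominated[OF _ g p Linf_norm_nonneg[of X S]])
  show "(\<lambda>t. S t * g t) \<in> borel_measurable (lebesgue_on X)"
    using Lp_space_measurable[OF S] Lp_space_measurable[OF g] by measurable
  show "AE t in lebesgue_on X. \<bar>S t * g t\<bar> \<le> Linf_norm X S * \<bar>g t\<bar>"
    using AE_Linf_norm[OF S] by eventually_elim (simp add: abs_mult mult_right_mono)
qed

section \<open>Operators glued from affine pieces\<close>

text \<open>
  The data of the operator in the form in which it is used: $y\mapsto d_i+c_iy$ is the affine
  extension of $u_i^{-1}$, so $c_i$ is the reciprocal of the slope of $u_i$, and $y$ belongs to $u_i(X_i)$ iff $d_i+c_iy\in X_i$.
  Working with the inverse maps avoids inverse functions on sets; disjointness of the images
  $u_i(X_i)$ becomes the last condition on the geometry.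
\<close>

locale affine_pieces =
  fixes p :: ennreal and \<Omega> :: "real set" and I :: "'i set"
    and X :: "'i \<Rightarrow> real set" and c d :: "'i \<Rightarrow> real" and lam S :: "'i \<Rightarrow> real \<Rightarrow> real"
  assumes p: "0 < p" and \<Omega>: "\<Omega> \<in> sets lebesgue" and I: "finite I"
    and X: "\<And>i. i \<in> I \<Longrightarrow> X i \<in> sets lebesgue" "\<And>i. i \<in> I \<Longrightarrow> X i \<subseteq> \<Omega>"
    and c: "\<And>i. i \<in> I \<Longrightarrow> c i \<noteq> 0"
    and disjoint: "\<And>i j y. i \<in> I \<Longrightarrow> j \<in> I \<Longrightarrow> i \<noteq> j \<Longrightarrow> d i + c i * y \<in> X i \<Longrightarrow> d j + c j * y \<notin> X j"
    and lam: "\<And>i. i \<in> I \<Longrightarrow> lam i \<in> Lp_space p (X i)"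
    and S: "\<And>i. i \<in> I \<Longrightarrow> S i \<in> Lp_space \<infinity> (X i)"
begin

text \<open>
  All pointwise statements about the operator and about differences of its values concern sums of
  this one shape.
\<close>

definition glue :: "('i \<Rightarrow> real \<Rightarrow> real) \<Rightarrow> real \<Rightarrow> real" where
  "glue F y = (\<Sum>i\<in>I. F i (d i + c i * y) * indicator (X i) (d i + c i * y))"

definition rb :: "(real \<Rightarrow> real) \<Rightarrow> real \<Rightarrow> real" where
  "rb g = glue (\<lambda>i t. lam i t + S i t * g t)"

lemma rb_diff: "rb f y - rb g y = glue (\<lambda>i t. S i t * (f t - g t)) y"
  by (simp add: rb_def glue_def sum_subtractf[symmetric] algebra_simps)

text \<open>
  Disjointness of the pieces makes every glued sum collapse to at most one term, the same one for
  all families $F$; this is the reason why $p$-th powers pass through the sum without loss.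
\<close>

lemma glue_cases:
  obtains i where "i \<in> I" "d i + c i * y \<in> X i" "\<And>F. glue F y = F i (d i + c i * y)"
  | "\<And>F. glue F y = 0"
proof (cases "\<exists>i\<in>I. d i + c i * y \<in> X i")
  case True
  then obtain i where i: "i \<in> I" "d i + c i * y \<in> X i" by blast
  have "glue F y = F i (d i + c i * y)" for F
  proof -
    have "glue F y = (\<Sum>j\<in>{i}. F j (d j + c j * y) * indicator (X j) (d j + c j * y))"
      unfolding glue_def using I i disjoint[OF i(1) _ _ i(2)]
      by (intro sum.mono_neutral_right) (auto simp: indicator_def)
    then show ?thesis using i by simp
  qed
  then show ?thesis using that(1) i by blast
next
  case False
  then have "glue F y = 0" for F
    unfolding glue_def by (intro sum.neutral) (auto simp: indicator_def)
  then show ?thesis by (rule that(2))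
qed

lemma rb_in_Lp_space:
  assumes g: "g \<in> Lp_space p \<Omega>"
  shows "rb g \<in> Lp_space p \<Omega>"
  unfolding rb_def glue_def
proof (rule Lp_space_sum[OF I _ p])
  fix i assume i: "i \<in> I"
  have "g \<in> Lp_space p (X i)"
    using Lp_space_subset[OF g] X i p \<Omega> by blast
  then have "(\<lambda>t. lam i t + S i t * g t) \<in> Lp_space p (X i)"
    using lam[OF i] S[OF i] p by (intro Lp_space_add Lp_space_mult_Linf)
  from Lp_space_affine_pullback[OF c[OF i] X(1)[OF i] \<Omega> this]
  show "(\<lambda>y. (lam i (d i + c i * y) + S i (d i + c i * y) * g (d i + c i * y)) *
      indicator (X i) (d i + c i * y)) \<in> Lp_space p \<Omega>" .
qed

lemma AE_pieces:
  assumes "\<And>i. i \<in> I \<Longrightarrow> AE t in lebesgue_on (X i). P i t"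
  shows "AE y in lebesgue_on \<Omega>. \<forall>i\<in>I. d i + c i * y \<in> X i \<longrightarrow> P i (d i + c i * y)"
  using I assms X c
  by (intro AE_finite_allI AE_lebesgue_imp_lebesgue_on[OF \<Omega>] AE_affine_pullback_on) auto

lemma AE_subset_piece:
  assumes "i \<in> I" "AE t in lebesgue_on \<Omega>. P t"
  shows "AE t in lebesgue_on (X i). P t"
  using assms X[of i] \<Omega> by (auto simp: AE_restrict_space_iff elim!: eventually_mono)

text \<open>
  The operator is thus well defined on classes modulo equality almost everywhere.
\<close>

lemma rb_eq_ae:
  assumes "eq_ae \<Omega> f g"
  shows "eq_ae \<Omega> (rb f) (rb g)"
proof -
  have "AE y in lebesgue_on \<Omega>. \<forall>i\<in>I. d i + c i * y \<in> X i \<longrightarrow> f (d i + c i * y) = g (d i + c i * y)"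
    by (rule AE_pieces, rule AE_subset_piece) (use assms in \<open>auto simp: eq_ae_def\<close>)
  then show ?thesis
    unfolding eq_ae_def rb_def
  proof eventually_elim
    case (elim y)
    show ?case
      by (cases y rule: glue_cases) (use elim in auto)
  qed
qed

lemma Linf_norm_rb_diff_le:
  assumes f: "f \<in> Lp_space \<infinity> \<Omega>" and g: "g \<in> Lp_space \<infinity> \<Omega>" and "p = \<infinity>"
    and m: "0 \<le> m" "\<And>i. i \<in> I \<Longrightarrow> Linf_norm (X i) (S i) \<le> m"
  shows "Linf_norm \<Omega> (\<lambda>y. rb f y - rb g y) \<le> m * Linf_norm \<Omega> (\<lambda>t. f t - g t)"
proof (rule Linf_norm_le)
  let ?D = "Linf_norm \<Omega> (\<lambda>t. f t - g t)"
  show "(\<lambda>y. rb f y - rb g y) \<in> borel_measurable (lebesgue_on \<Omega>)"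
    using f g \<open>p = \<infinity>\<close> p by (intro Lp_space_measurable[of _ p] Lp_space_diff rb_in_Lp_space) auto
  show "0 \<le> m * ?D" using m by simp
  have fg: "(\<lambda>t. f t - g t) \<in> Lp_space \<infinity> \<Omega>"
    using f g by (intro Lp_space_diff) auto
  have "AE y in lebesgue_on \<Omega>. \<forall>i\<in>I. d i + c i * y \<in> X i \<longrightarrow>
    \<bar>S i (d i + c i * y) * (f (d i + c i * y) - g (d i + c i * y))\<bar> \<le> m * ?D"
  proof (rule AE_pieces)
    fix i assume i: "i \<in> I"
    show "AE t in lebesgue_on (X i). \<bar>S i t * (f t - g t)\<bar> \<le> m * ?D"
      using AE_Linf_norm[OF S[OF i]] AE_subset_piece[OF i AE_Linf_norm[OF fg]]
    proof eventually_elim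
      case (elim t)
      then show ?case
        using m(2)[OF i] m(1) by (auto simp: abs_mult intro!: mult_mono)
    qed
  qed
  then show "AE y in lebesgue_on \<Omega>. \<bar>rb f y - rb g y\<bar> \<le> m * ?D"
  proof eventually_elim
    case (elim y)
    show ?case
      unfolding rb_diff by (cases y rule: glue_cases) (use elim m(1) in auto)
  qed
qed

text \<open>
  The change of variables $t=d_i+c_iy$ contributes $1/|c_i|$ and the essential bound of $S_i$ its
  $p$-th power; integrals over $X_i$ are then enlarged to $\Omega$. Nonnegative integrals carry the
  computation, and integrability enters only when they are turned into real ones at the end.
\<close>

lemma integral_rb_diff_le:
  assumes f: "f \<in> Lp_space p \<Omega>" and g: "g \<in> Lp_space p \<Omega>" and fin: "p \<noteq> \<infinity>"
  shows "(\<integral>y. \<bar>rb f y - rb g y\<bar> powr enn2real p \<partial>lebesgue_on \<Omega>) \<le>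
    (\<Sum>i\<in>I. Linf_norm (X i) (S i) powr enn2real p / \<bar>c i\<bar>) *
    (\<integral>t. \<bar>f t - g t\<bar> powr enn2real p \<partial>lebesgue_on \<Omega>)"
proof -
  let ?q = "enn2real p"
  let ?h = "\<lambda>t. \<bar>f t - g t\<bar> powr ?q" and ?rbh = "\<lambda>y. \<bar>rb f y - rb g y\<bar> powr ?q"
  let ?l = "\<lambda>i. Linf_norm (X i) (S i) powr ?q"
  let ?F = "\<lambda>i t. \<bar>S i t * (f t - g t)\<bar> powr ?q"
  have q: "0 < ?q" using p fin by (rule enn2real_exponent_pos)
  have int_h: "integrable (lebesgue_on \<Omega>) ?h"
    using Lp_space_diff[OF f g p] fin by (simp add: Lp_space_def)
  have int_rbh: "integrable (lebesgue_on \<Omega>) ?rbh"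
    using Lp_space_diff[OF rb_in_Lp_space[OF f] rb_in_Lp_space[OF g] p] fin by (simp add: Lp_space_def)
  have h_meas: "(\<lambda>t. f t - g t) \<in> borel_measurable (lebesgue_on (X i))" if "i \<in> I" for i
    using Lp_space_measurable[OF Lp_space_diff[OF f g p]] X(2)[OF that]
    by (rule measurable_restrict_mono)
  have h_powr_meas: "?h \<in> borel_measurable (lebesgue_on (X i))" if "i \<in> I" for i
    using measurable_compose[OF h_meas[OF that], of "\<lambda>v. \<bar>v\<bar> powr ?q" borel] by simp
  have F_meas: "?F i \<in> borel_measurable (lebesgue_on (X i))" if "i \<in> I" for i
    using measurable_compose[OF borel_measurable_times[OF Lp_space_measurable[OF S[OF that]]
          h_meas[OF that]], of "\<lambda>v. \<bar>v\<bar> powr ?q" borel] by simp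
  have piece: "(\<integral>\<^sup>+t. ?F i t \<partial>lebesgue_on (X i)) \<le> ennreal (?l i) * (\<integral>\<^sup>+t. ?h t \<partial>lebesgue_on \<Omega>)"
    if i: "i \<in> I" for i
  proof -
    have "(\<integral>\<^sup>+t. ?F i t \<partial>lebesgue_on (X i)) \<le> (\<integral>\<^sup>+t. ennreal (?l i) * ennreal (?h t) \<partial>lebesgue_on (X i))"
    proof (rule nn_integral_mono_AE)
      show "AE t in lebesgue_on (X i). ennreal (?F i t) \<le> ennreal (?l i) * ennreal (?h t)"
        using AE_Linf_norm[OF S[OF i]]
      proof eventually_elim
        case (elim t)
        have "?F i t = \<bar>S i t\<bar> powr ?q * ?h t" by (simp add: abs_mult powr_mult)
        also have "\<dots> \<le> ?l i * ?h t"
          using elim q by (intro mult_right_mono powr_mono2) auto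
        finally show ?case by (simp add: ennreal_mult[symmetric] ennreal_leI)
      qed
    qed
    also have "\<dots> = ennreal (?l i) * (\<integral>\<^sup>+t. ?h t \<partial>lebesgue_on (X i))"
      using h_powr_meas[OF i] by (intro nn_integral_cmult measurable_compose[OF _ measurable_ennreal])
    also have "(\<integral>\<^sup>+t. ?h t \<partial>lebesgue_on (X i)) \<le> (\<integral>\<^sup>+t. ?h t \<partial>lebesgue_on \<Omega>)"
      using X[OF i] \<Omega>
      by (simp add: nn_integral_restrict_space) (intro nn_integral_mono, auto simp: indicator_def)
    finally show ?thesis by (simp add: mult_left_mono)
  qed
  have "(\<integral>\<^sup>+y. ?rbh y \<partial>lebesgue_on \<Omega>) \<le> (\<integral>\<^sup>+y. ?rbh y \<partial>lebesgue)"
    using \<Omega> by (subst nn_integral_restrict_space) (auto intro!: nn_integral_mono simp: indicator_def)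
  also have "\<dots> = (\<integral>\<^sup>+y. (\<Sum>i\<in>I. ennreal (?F i (d i + c i * y)) * indicator (X i) (d i + c i * y)) \<partial>lebesgue)"
  proof (rule nn_integral_cong)
    fix y :: real
    have "?rbh y = glue ?F y"
      unfolding rb_diff by (cases y rule: glue_cases) auto
    then show "ennreal (?rbh y) = (\<Sum>i\<in>I. ennreal (?F i (d i + c i * y)) * indicator (X i) (d i + c i * y))"
      by (simp add: glue_def sum_ennreal[symmetric] ennreal_mult ennreal_indicator)
  qed
  also have "\<dots> = (\<Sum>i\<in>I. \<integral>\<^sup>+y. ennreal (?F i (d i + c i * y)) * indicator (X i) (d i + c i * y) \<partial>lebesgue)"
  proof (rule nn_integral_sum)
    fix i assume i: "i \<in> I"
    have "(\<lambda>y. ?F i (d i + c i * y) * indicator (X i) (d i + c i * y)) \<in> borel_measurable lebesgue"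
      by (rule borel_measurable_affine_pullback[OF c[OF i] X(1)[OF i] F_meas[OF i]])
    from measurable_compose[OF this measurable_ennreal] show "(\<lambda>y. ennreal (?F i (d i + c i * y)) * indicator (X i) (d i + c i * y)) \<in> borel_measurable lebesgue"
      by (simp add: ennreal_mult ennreal_indicator)
  qed
  also have "\<dots> = (\<Sum>i\<in>I. ennreal (1 / \<bar>c i\<bar>) * (\<integral>\<^sup>+t. ?F i t \<partial>lebesgue_on (X i)))"
  proof (rule sum.cong[OF refl])
    fix i assume i: "i \<in> I"
    show "(\<integral>\<^sup>+y. ennreal (?F i (d i + c i * y)) * indicator (X i) (d i + c i * y) \<partial>lebesgue) =
      ennreal (1 / \<bar>c i\<bar>) * (\<integral>\<^sup>+t. ?F i t \<partial>lebesgue_on (X i))"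
      by (rule nn_integral_affine_pullback[OF c[OF i] X(1)[OF i]
            measurable_compose[OF F_meas[OF i] measurable_ennreal]])
  qed
  also have "\<dots> \<le> (\<Sum>i\<in>I. ennreal (1 / \<bar>c i\<bar>) * (ennreal (?l i) * (\<integral>\<^sup>+t. ?h t \<partial>lebesgue_on \<Omega>)))"
    using piece by (intro sum_mono mult_left_mono) auto
  also have "\<dots> = (\<Sum>i\<in>I. ennreal (?l i / \<bar>c i\<bar>)) * (\<integral>\<^sup>+t. ?h t \<partial>lebesgue_on \<Omega>)"
    by (simp add: sum_distrib_right mult.assoc[symmetric] ennreal_mult[symmetric] del: sum_ennreal)
  also have "(\<integral>\<^sup>+t. ?h t \<partial>lebesgue_on \<Omega>) = ennreal (\<integral>t. ?h t \<partial>lebesgue_on \<Omega>)"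
    using int_h by (intro nn_integral_eq_integral) auto
  also have "(\<integral>\<^sup>+y. ?rbh y \<partial>lebesgue_on \<Omega>) = ennreal (\<integral>y. ?rbh y \<partial>lebesgue_on \<Omega>)"
    using int_rbh by (intro nn_integral_eq_integral) auto
  finally have "ennreal (\<integral>y. ?rbh y \<partial>lebesgue_on \<Omega>) \<le>
      ennreal ((\<Sum>i\<in>I. ?l i / \<bar>c i\<bar>) * (\<integral>t. ?h t \<partial>lebesgue_on \<Omega>))"
    by (simp add: sum_ennreal ennreal_mult sum_nonneg)
  then show ?thesis
    by (subst (asm) ennreal_le_iff) (auto intro!: mult_nonneg_nonneg sum_nonneg)
qed

lemma contractive_infinite_exponent:
  assumes "p = \<infinity>" and m: "0 \<le> m" "m < 1" "\<And>i. i \<in> I \<Longrightarrow> Linf_norm (X i) (S i) \<le> m"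
  shows "contractive_on_Lp p \<Omega> rb"
  unfolding contractive_on_Lp_def \<open>p = \<infinity>\<close> Lp_dist_infinity
  using Linf_norm_rb_diff_le[OF _ _ \<open>p = \<infinity>\<close> m(1,3)] m by blast

text \<open>
  For $p<1$ the metric is the integral itself and the Lipschitz constant is the sum; for $p\ge1$ it
  is the $p$-th root of the sum, which is less than 1 together with it.
\<close>

lemma contractive_finite_exponent:
  assumes fin: "p \<noteq> \<infinity>"
    and k: "(\<Sum>i\<in>I. Linf_norm (X i) (S i) powr enn2real p / \<bar>c i\<bar>) < 1" (is "?k < 1")
  shows "contractive_on_Lp p \<Omega> rb"
proof -
  let ?q = "enn2real p"
  have q: "0 < ?q" using p fin by (rule enn2real_exponent_pos)
  have k0: "0 \<le> ?k" by (intro sum_nonneg) auto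
  note le = integral_rb_diff_le[OF _ _ fin]
  show ?thesis
  proof (cases "p < 1")
    case True
    then show ?thesis
      unfolding contractive_on_Lp_def using le k k0 fin
      by (intro exI[of _ ?k]) (simp add: Lp_dist_finite)
  next
    case False
    have "Lp_dist p \<Omega> (rb f) (rb g) \<le> ?k powr (1 / ?q) * Lp_dist p \<Omega> f g"
      if "f \<in> Lp_space p \<Omega>" "g \<in> Lp_space p \<Omega>" for f g
    proof -
      have "Lp_dist p \<Omega> (rb f) (rb g) \<le> (?k * (\<integral>t. \<bar>f t - g t\<bar> powr ?q \<partial>lebesgue_on \<Omega>)) powr (1 / ?q)"
        using le[OF that] False fin q by (simp add: Lp_dist_finite powr_mono2)
      then show ?thesis
        using False fin k0 by (simp add: Lp_dist_finite powr_mult)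
    qed
    moreover have "?k powr (1 / ?q) < 1" using powr_lt_one[OF k0 k] q by simp
    ultimately show ?thesis
      unfolding contractive_on_Lp_def by (intro exI[of _ "?k powr (1 / ?q)"]) simp
  qed
qed

end

section \<open>The Read-Bajraktarevic operator\<close>

lemma lipschitz_const_affine:
  assumes X: "s \<in> X" "t \<in> X" "s \<noteq> t" and u: "\<And>t. u t = a * t + b"
  shows "lipschitz_const X u = \<bar>a\<bar>"
  unfolding lipschitz_const_def
proof (rule cInf_eq_minimum)
  have diff: "dist (u v) (u w) = \<bar>a\<bar> * dist v w" for v w
    by (simp add: u dist_real_def abs_mult[symmetric] algebra_simps)
  show "\<bar>a\<bar> \<in> {L. L-lipschitz_on X u}"
    by (auto intro!: lipschitz_onI simp: diff)
  show "\<bar>a\<bar> \<le> L" if "L \<in> {L. L-lipschitz_on X u}" for L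
  proof -
    have "\<bar>a\<bar> * dist s t \<le> L * dist s t"
      using that X lipschitz_onD[of L X u s t] by (simp add: diff)
    then show ?thesis using X(3) by (simp add: mult_le_cancel_right)
  qed
qed

lemma half_open_interval_measurable:
  "half_open_interval X \<Longrightarrow> X \<in> sets lebesgue"
  by (auto simp: half_open_interval_def)

lemma partition_mono:
  fixes x :: "nat \<Rightarrow> real"
  assumes "\<And>i. i \<in> {1..N} \<Longrightarrow> x (i - 1) < x i" and "i \<le> j" "j \<le> N"
  shows "x i \<le> x j"
  using assms(2,3)
proof (induction j rule: dec_induct)
  case (step j)
  then show ?case using assms(1)[of "Suc j"] by simp
qed simp

text \<open>
  On $u_i(X_i)$ the inverse of $u_i$ on $X_i$ agrees with the inverse affine map of the line, and
  $y\in u_i(X_i)$ iff that map sends $y$ into $X_i$. So both the inverse and the indicator can be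
  expressed by the inverse affine map.
\<close>

lemma RB_operator_eq_sum:
  assumes "\<And>i t. i \<in> {1..N} \<Longrightarrow> u i t = a i * t + b i" and "\<And>i. i \<in> {1..N} \<Longrightarrow> a i \<noteq> 0"
  shows "RB_operator N X u lam S g y =
    (\<Sum>i\<in>{1..N}. (lam i (- b i / a i + 1 / a i * y) +
        S i (- b i / a i + 1 / a i * y) * g (- b i / a i + 1 / a i * y)) *
      indicator (X i) (- b i / a i + 1 / a i * y))"
  unfolding RB_operator_def sum.distrib[symmetric]
proof (rule sum.cong[OF refl])
  fix i assume i: "i \<in> {1..N}"
  let ?v = "- b i / a i + 1 / a i * y"
  have uv: "u i ?v = y" using assms[OF i] by (simp add: field_simps)
  have inj: "u i s = u i t \<longleftrightarrow> s = t" for s t using assms[OF i] by simp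
  have "inv_into (X i) (u i) y = ?v" if "?v \<in> X i"
    using that inj uv by (intro inv_into_f_eq inj_onI) auto
  moreover have "y \<in> u i ` X i \<longleftrightarrow> ?v \<in> X i"
    using uv inj by (metis imageE imageI)
  ultimately show "(lam i \<circ> inv_into (X i) (u i)) y * indicator (u i ` X i) y +
      (S i \<circ> inv_into (X i) (u i)) y * (restrict g (X i) \<circ> inv_into (X i) (u i)) y *
        indicator (u i ` X i) y =
      (lam i ?v + S i ?v * g ?v) * indicator (X i) ?v"
    by (cases "?v \<in> X i") simp_all
qed

theorem theorem7:
  fixes N :: nat
    and X :: "nat \<Rightarrow> real set"
    and x :: "nat \<Rightarrow> real"
    and u lam S :: "nat \<Rightarrow> real \<Rightarrow> real"
    and p :: ennreal
  assumes "1 \<le> N"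
    and "\<And>i. i \<in> {1..N} \<Longrightarrow> half_open_interval (X i) \<and> X i \<subseteq> {0..1}"
    and "x 0 = 0" and "x N = 1"
    and "\<And>i. i \<in> {1..N} \<Longrightarrow> x (i - 1) < x i"
    and "\<And>i. i \<in> {1..N} \<Longrightarrow> affine_map (u i)"
    and "\<And>i. i \<in> {1..N} \<Longrightarrow> u i ` X i = {x (i - 1)..<x i}"
    and "u N ` adjoin_endpoint (u N) (X N) = {x (N - 1)..x N}"
    and "0 < p"
    and "\<And>i. i \<in> {1..N} \<Longrightarrow> lam i \<in> Lp_space_into p (X i) {0..1}"
    and "\<And>i. i \<in> {1..N} \<Longrightarrow> S i \<in> Lp_space \<infinity> (X i)"
  defines "\<Phi> \<equiv> RB_operator N X u lam S"
  shows "(\<forall>g\<in>Lp_space p {0..1}. \<Phi> g \<in> Lp_space p {0..1}) \<and>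
    (\<forall>f\<in>Lp_space p {0..1}. \<forall>g\<in>Lp_space p {0..1}.
       eq_ae {0..1} f g \<longrightarrow> eq_ae {0..1} (\<Phi> f) (\<Phi> g)) \<and>
    (contraction_condition p N X u S \<longrightarrow>
       contractive_on_Lp p {0..1} \<Phi> \<and>
       (\<exists>f\<in>Lp_space p {0..1}. eq_ae {0..1} (\<Phi> f) f \<and>
          (\<forall>g\<in>Lp_space p {0..1}. eq_ae {0..1} (\<Phi> g) g \<longrightarrow> eq_ae {0..1} g f)))"
proof -
  have "\<forall>i\<in>{1..N}. \<exists>a b. \<forall>t. u i t = a * t + b"
    using assms(6) by (simp add: affine_map_def)
  then obtain a b where u: "\<And>i t. i \<in> {1..N} \<Longrightarrow> u i t = a i * t + b i"
    by metis
  \<comment> \<open>A half-open interval of positive length is not the image of a constant map; the left end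
    and the midpoint of the image witness nondegeneracy.\<close>
  have two_points: "\<exists>s\<in>X i. \<exists>t\<in>X i. u i s \<noteq> u i t" if i: "i \<in> {1..N}" for i
  proof -
    let ?m = "(x (i - 1) + x i) / 2"
    have "x (i - 1) \<in> u i ` X i" "?m \<in> u i ` X i" "x (i - 1) \<noteq> ?m"
      using assms(5)[OF i] by (auto simp: assms(7)[OF i])
    then show ?thesis by (metis imageE)
  qed
  have a: "a i \<noteq> 0" if "i \<in> {1..N}" for i
    using two_points[OF that] u[OF that] by auto
  have lip: "lipschitz_const (X i) (u i) = \<bar>a i\<bar>" if i: "i \<in> {1..N}" for i
    using two_points[OF i] lipschitz_const_affine[OF _ _ _ u[OF i]] by metis
  have pieces_disjoint: "u i ` X i \<inter> u j ` X j = {}" if ij: "i \<in> {1..N}" "j \<in> {1..N}" "i < j" for i j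
  proof -
    \<comment> \<open>The image of piece i ends before the image of any later piece begins.\<close>
    have "x i \<le> x (j - 1)" using ij by (intro partition_mono[of N x, OF assms(5)]) auto
    then show ?thesis by (auto simp: assms(7)[OF ij(1)] assms(7)[OF ij(2)])
  qed
  have pullback_in: "y \<in> u i ` X i"
    if "i \<in> {1..N}" "- b i / a i + 1 / a i * y \<in> X i" for i y
  proof -
    have "u i (- b i / a i + 1 / a i * y) = y" using u a that(1) by (simp add: field_simps)
    then show ?thesis using that(2) by (metis imageI)
  qed
  interpret affine_pieces p "{0..1}" "{1..N}" X "\<lambda>i. 1 / a i" "\<lambda>i. - b i / a i" lam S
  proof unfold_locales
    fix i j y
    assume ij: "i \<in> {1..N}" "j \<in> {1..N}" "i \<noteq> j" "- b i / a i + 1 / a i * y \<in> X i"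
    show "- b j / a j + 1 / a j * y \<notin> X j"
      using pullback_in[OF ij(1,4)] pullback_in[OF ij(2)] pieces_disjoint[OF ij(1,2)]
        pieces_disjoint[OF ij(2,1)] ij(3) by (metis disjoint_iff linorder_neqE_nat)
  next
    fix i assume "i \<in> {1..N}"
    then show "lam i \<in> Lp_space p (X i)"
      using assms(10) by (simp add: Lp_space_into_def)
  qed (use assms a half_open_interval_measurable in auto)
  have \<Phi>: "\<Phi> = rb"
    unfolding \<Phi>_def rb_def[abs_def] glue_def[abs_def]
    by (intro ext RB_operator_eq_sum u a)
  have contr: "contractive_on_Lp p {0..1} \<Phi>" if cond: "contraction_condition p N X u S"
  proof (cases "p = \<infinity>")
    case True
    let ?n = "(\<lambda>i. Linf_norm (X i) (S i)) ` {1..N}"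
    have le_Max: "Linf_norm (X i) (S i) \<le> Max ?n" if "i \<in> {1..N}" for i
      using that by (intro Max_ge) auto
    moreover have "0 \<le> Max ?n"
      by (rule order.trans[OF Linf_norm_nonneg le_Max[of 1]]) (use assms(1) in simp)
    moreover have "Max ?n < 1" using cond True by (simp add: contraction_condition_def)
    ultimately show ?thesis
      unfolding \<Phi> using True by (intro contractive_infinite_exponent)
  next
    case False
    let ?q = "enn2real p"
    have q: "0 < ?q" using p False by (rule enn2real_exponent_pos)
    let ?k = "\<Sum>i\<in>{1..N}. Linf_norm (X i) (S i) powr ?q / \<bar>1 / a i\<bar>"
    have k_eq: "(\<Sum>i=1..N. lipschitz_const (X i) (u i) * Linf_norm (X i) (S i) powr ?q) = ?k"
      by (intro sum.cong) (auto simp: lip mult.commute)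
    have k0: "0 \<le> ?k" by (intro sum_nonneg) auto
    have "?k < 1"
    proof (cases "p < 1")
      case True
      then show ?thesis using cond False unfolding contraction_condition_def k_eq by simp
    next
      case p1: False
      then have "?k powr (1 / ?q) < 1"
        using cond False unfolding contraction_condition_def k_eq by simp
      then show ?thesis using ge_one_powr_ge_zero[of ?k "1 / ?q"] q by (meson divide_nonneg_pos not_less zero_le_one)
    qed
    then show ?thesis unfolding \<Phi> by (rule contractive_finite_exponent[OF False])
  qed
  show ?thesis
  proof (intro conjI ballI impI)
    show "\<Phi> g \<in> Lp_space p {0..1}" if "g \<in> Lp_space p {0..1}" for g
      unfolding \<Phi> using that by (rule rb_in_Lp_space)
    show "eq_ae {0..1} (\<Phi> f) (\<Phi> g)" if "eq_ae {0..1} f g" for f g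
      unfolding \<Phi> using that by (rule rb_eq_ae)
    assume cond: "contraction_condition p N X u S"
    show "contractive_on_Lp p {0..1} \<Phi>" by (rule contr[OF cond])
    show "\<exists>f\<in>Lp_space p {0..1}. eq_ae {0..1} (\<Phi> f) f \<and>
          (\<forall>g\<in>Lp_space p {0..1}. eq_ae {0..1} (\<Phi> g) g \<longrightarrow> eq_ae {0..1} g f)"
      using contr[OF cond] rb_in_Lp_space unfolding \<Phi>
      by (intro Lp_contraction_fixed_point p)
  qed
qed

end
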